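(* Let $G$ be a finite connected undirected graph on $n$ vertices whose edges $e$ have positive real lengths $\ell(e)$, such that the distances $d(v,w)$ between pairs of distinct vertices are all distinct, and let $v_0$ be any vertex of $G$. Let $L_{NUV} = L_{NUV}(G,v_0)$ be the length of the nearest unvisited vertex walk on $G$ started from $v_0$, and for $r>0$ let $N(r)=N(G,r)$ be the minimal size of a set $S$ of vertices such that every vertex of $G$ is within distance $r$ from some element of $S$. Then: (i) $N(r) \le 1 + L_{NUV}/r$ for all $0<r<\infty$. (ii) $L_{NUV} \le 2\int_0^{\Delta/2} N(r)\,dr$, where $\Delta = \max_{v,w} d(v,w)$ is the diameter of the graph.
   Context: The length of a path is the sum of its edge-lengths, and the distance $d(v,w)$ between two vertices is the length of the shortest path between them. "Within distance $r$" means distance $\le r$. The nearest unvisited vertex (NUV) walk from $v_0$ is the deterministic walk which, after arriving at a vertex, next moves along the shortest path to the closest (in the distance $d$) unvisited vertex, and continues until every vertex has been visited. Explicitly, the vertices in order of first visit are $v_0,v_1,\ldots,v_{n-1}$ where $$v_i = \arg\min_{v\notin\{v_0,\ldots,v_{i-1}\}} d(v_{i-1},v),\quad 1\le i\le n-1,$$ and the length of the walk is $L_{NUV}(G,v_0) = \sum_{i=1}^{n-1} d(v_{i-1},v_i)$ (the walk does not return to its start). *)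

theory Defs
  imports "HOL-Analysis.Analysis" "Graph_Theory.Graph_Theory"
begin

text \<open>
  An undirected graph is a symmetric digraph (locale \<open>graph\<close> of \<open>Graph_Theory\<close>: finite, loop-free,
  no parallel arcs), so an undirected edge is a pair of opposite arcs. Edge lengths are therefore
  weights on arcs which agree on the two arcs of an edge.
\<close>

definition edge_lengths :: "('a, 'b) pre_digraph \<Rightarrow> 'b weight_fun \<Rightarrow> bool" where
  "edge_lengths G l \<longleftrightarrow>
     (\<forall>e\<in>arcs G. 0 < l e) \<and>
     (\<forall>e\<in>arcs G. \<forall>e'\<in>arcs G. tail G e' = head G e \<and> head G e' = tail G e \<longrightarrow> l e' = l e)"

text \<open>
  The library's distance \<open>\<mu>\<close> is an extended real (infinite for unreachable pairs) and an infimum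
  over walks; in a graph with positive edge lengths it is attained by a path, see
  \<open>graph_dist_shortest_path\<close> below.
\<close>

definition graph_dist :: "('a, 'b) pre_digraph \<Rightarrow> 'b weight_fun \<Rightarrow> 'a \<Rightarrow> 'a \<Rightarrow> real" where
  "graph_dist G l u v = real_of_ereal (wf_digraph.\<mu> G l u v)"

lemma (in graph) graph_dist_shortest_path:
  assumes "connected G" and "edge_lengths G l" and "u \<in> verts G" and "v \<in> verts G"
  shows "\<exists>p. apath u p v \<and> graph_dist G l u v = awalk_cost l p"
    and "\<And>p. apath u p v \<Longrightarrow> graph_dist G l u v \<le> awalk_cost l p"
proof -
  have pos: "\<And>e. e \<in> arcs G \<Longrightarrow> 0 \<le> l e"
    using assms(2) unfolding edge_lengths_def by force
  have "strongly_connected G"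
    using assms(1) sym_arcs symmetric_connected_imp_strongly_connected by blast
  then have "u \<rightarrow>\<^sup>*\<^bsub>G\<^esub> v"
    using assms(3,4) by (simp add: strongly_connected_def)
  then obtain q where q: "apath u q v" "\<mu> l u v = awalk_cost l q"
    using min_cost_awalk pos by blast
  then show "\<exists>p. apath u p v \<and> graph_dist G l u v = awalk_cost l p"
    by (auto simp: graph_dist_def)
  show "graph_dist G l u v \<le> awalk_cost l p" if "apath u p v" for p
    using min_cost_le_walk_cost[of u p v l] that q(2)
    by (simp add: graph_dist_def apath_def)
qed

definition distinct_distances :: "('a, 'b) pre_digraph \<Rightarrow> 'b weight_fun \<Rightarrow> bool" where
  "distinct_distances G l \<longleftrightarrow>
     (\<forall>u\<in>verts G. \<forall>v\<in>verts G. \<forall>u'\<in>verts G. \<forall>v'\<in>verts G.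
        u \<noteq> v \<and> u' \<noteq> v' \<and> graph_dist G l u v = graph_dist G l u' v' \<longrightarrow> {u, v} = {u', v'})"

definition graph_diameter :: "('a, 'b) pre_digraph \<Rightarrow> 'b weight_fun \<Rightarrow> real" where
  "graph_diameter G l = Max {graph_dist G l u v | u v. u \<in> verts G \<and> v \<in> verts G}"

text \<open>
  \<open>nuv G l v0 i\<close> is the vertex $v_i$. It is meaningful for \<open>i < card (verts G)\<close>
  only (afterwards no unvisited vertex is left), where under \<open>distinct_distances\<close> the minimiser is
  unique.
\<close>

fun nuv :: "('a, 'b) pre_digraph \<Rightarrow> 'b weight_fun \<Rightarrow> 'a \<Rightarrow> nat \<Rightarrow> 'a" where
  "nuv G l v0 0 = v0"
| "nuv G l v0 (Suc i) =
     arg_min_on (graph_dist G l (nuv G l v0 i)) (verts G - nuv G l v0 ` {..i})"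

definition nuv_length :: "('a, 'b) pre_digraph \<Rightarrow> 'b weight_fun \<Rightarrow> 'a \<Rightarrow> real" where
  "nuv_length G l v0 =
     (\<Sum>i = 1..card (verts G) - 1. graph_dist G l (nuv G l v0 (i - 1)) (nuv G l v0 i))"

definition is_cover :: "('a, 'b) pre_digraph \<Rightarrow> 'b weight_fun \<Rightarrow> real \<Rightarrow> 'a set \<Rightarrow> bool" where
  "is_cover G l r S \<longleftrightarrow> S \<subseteq> verts G \<and> (\<forall>v\<in>verts G. \<exists>s\<in>S. graph_dist G l s v \<le> r)"

definition covering_number :: "('a, 'b) pre_digraph \<Rightarrow> 'b weight_fun \<Rightarrow> real \<Rightarrow> nat" where
  "covering_number G l r = (LEAST k. \<exists>S. is_cover G l r S \<and> card S = k)"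

end

theory Submission
  imports Defs
begin

text \<open>
  (i) Cut the walk into pieces of length \<open>r\<close>; the first vertices visited in the pieces form a cover.
  (ii) If the walk leaves \<open>v\<close> by a step longer than \<open>2r\<close>, then every vertex unvisited at that time is
  farther than \<open>2r\<close> from \<open>v\<close>. So the starting points of the steps longer than \<open>2r\<close> are pairwise
  farther than \<open>2r\<close> apart, each of them needs its own centre in a cover of radius \<open>r\<close>, and hence at
  most \<open>N(r)\<close> steps are longer than \<open>2r\<close>. Integrating over \<open>r\<close> gives half the length of the walk.
\<close>

section \<open>The shortest-path distance is a metric\<close>

locale length_graph = graph G for G :: "('a, 'b) pre_digraph" (structure) +
  fixes l :: "'b \<Rightarrow> real"
  assumes connected_graph: "Digraph_Component.connected G"
    and edge_lengths: "edge_lengths G l"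
begin

abbreviation dst :: "'a \<Rightarrow> 'a \<Rightarrow> real" where
  "dst \<equiv> graph_dist G l"

lemma dst_attained:
  assumes "u \<in> verts G" "v \<in> verts G"
  obtains p where "awalk u p v" "dst u v = awalk_cost l p"
  using graph_dist_shortest_path(1)[OF connected_graph edge_lengths assms]
  by (auto simp: apath_def)

lemma length_nonneg: "e \<in> arcs G \<Longrightarrow> 0 \<le> l e"
  using edge_lengths unfolding edge_lengths_def by force

text \<open>Concatenating two shortest paths may repeat vertices, so the triangle inequality needs
  this bound for arbitrary walks and not only for an \<open>apath\<close>.\<close>

lemma dst_le_awalk_cost:
  assumes "awalk u p v"
  shows "dst u v \<le> awalk_cost l p"
proof -
  have "u \<rightarrow>\<^sup>* v"
    using assms by (auto simp: reachable_awalk)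
  \<comment> \<open>A walk attaining the infimum shows that it is finite, so
    \<open>real_of_ereal\<close> does not fall back on its default value.\<close>
  then obtain q where "\<mu> l u v = awalk_cost l q"
    using min_cost_awalk length_nonneg by blast
  then show ?thesis
    using min_cost_le_walk_cost[OF assms, of l] by (simp add: graph_dist_def)
qed

lemma dst_nonneg:
  assumes "u \<in> verts G" "v \<in> verts G"
  shows "0 \<le> dst u v"
  by (metis assms dst_attained pos_cost_pos_awalk_cost length_nonneg)

lemma dst_self [simp]: "v \<in> verts G \<Longrightarrow> dst v v = 0"
  using dst_le_awalk_cost[of v "[]" v] dst_nonneg[of v v] by (simp add: awalk_Nil_iff)

lemma dst_triangle:
  assumes "u \<in> verts G" "v \<in> verts G" "w \<in> verts G"
  shows "dst u w \<le> dst u v + dst v w"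
proof -
  obtain p where p: "awalk u p v" "dst u v = awalk_cost l p"
    using assms dst_attained by blast
  obtain q where q: "awalk v q w" "dst v w = awalk_cost l q"
    using assms dst_attained by blast
  show ?thesis
    using dst_le_awalk_cost[of u "p @ q" w] p q by (simp add: awalk_appendI)
qed

text \<open>Each arc is replaced by its opposite, which exists by symmetry of the digraph and has
  the same length by \<open>edge_lengths\<close>. Symmetry of \<open>dst\<close> follows.\<close>

lemma awalk_reverse:
  assumes "awalk u p v"
  shows "\<exists>q. awalk v q u \<and> awalk_cost l q = awalk_cost l p"
  using assms
proof (induction p arbitrary: u)
  case Nil
  then show ?case by (auto simp: awalk_Nil_iff intro!: exI[of _ "[]"])
next
  case (Cons e p)
  then have e: "e \<in> arcs G" "tail G e = u" and "awalk (head G e) p v"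
    by (auto simp: awalk_Cons_iff)
  then obtain q where q: "awalk v q (head G e)" "awalk_cost l q = awalk_cost l p"
    using Cons.IH by blast
  obtain e' where e': "e' \<in> arcs G" "tail G e = head G e'" "head G e = tail G e'"
    using sym_arcs e(1) unfolding symmetric_conv by blast
  then have "l e' = l e"
    using edge_lengths e(1) unfolding edge_lengths_def by metis
  moreover have "awalk (head G e) [e'] u"
    using e e' by (auto simp: awalk_Cons_iff awalk_Nil_iff)
  ultimately show ?case
    using q by (intro exI[of _ "q @ [e']"]) (auto intro: awalk_appendI)
qed

lemma dst_commute:
  assumes "u \<in> verts G" "v \<in> verts G"
  shows "dst u v = dst v u"
proof -
  have "dst v u \<le> dst u v" if uv: "u \<in> verts G" "v \<in> verts G" for u v
  proof -
    obtain p where p: "awalk u p v" "dst u v = awalk_cost l p"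
      using uv dst_attained by blast
    then show ?thesis
      using awalk_reverse[OF p(1)] dst_le_awalk_cost by force
  qed
  then show ?thesis using assms by (meson antisym)
qed

lemma dst_le_diameter:
  assumes "u \<in> verts G" "v \<in> verts G"
  shows "dst u v \<le> graph_diameter G l"
proof -
  have "{dst u v |u v. u \<in> verts G \<and> v \<in> verts G} = (\<lambda>(u, v). dst u v) ` (verts G \<times> verts G)"
    by auto
  then have "finite {dst u v |u v. u \<in> verts G \<and> v \<in> verts G}"
    by simp
  then show ?thesis
    unfolding graph_diameter_def using assms by (auto intro: Max_ge)
qed

section \<open>Covering numbers and separated sets\<close>

lemma covering_number_le: "is_cover G l r S \<Longrightarrow> covering_number G l r \<le> card S"
  unfolding covering_number_def by (auto intro: Least_le)

text \<open>The set of all vertices is a cover, since \<open>dst v v = 0\<close>, so the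
  \<open>LEAST\<close> in the definition ranges over a nonempty set. For negative radii no cover
  exists and the value is unspecified.\<close>

lemma covering_number_attained:
  assumes "0 \<le> r"
  obtains S where "is_cover G l r S" "card S = covering_number G l r"
proof -
  have "is_cover G l r (verts G)"
    using assms by (auto simp: is_cover_def intro!: bexI[of _ v for v])
  then have "\<exists>k S. is_cover G l r S \<and> card S = k"
    by blast
  from LeastI_ex[OF this] show ?thesis
    using that unfolding covering_number_def by blast
qed

lemma covering_number_antimono:
  assumes "0 \<le> r" "r \<le> s"
  shows "covering_number G l s \<le> covering_number G l r"
proof -
  obtain S where S: "is_cover G l r S" "card S = covering_number G l r"
    using assms(1) covering_number_attained by blast
  then have "is_cover G l s S"
    using assms(2) by (force simp: is_cover_def)
  with S(2) show ?thesis
    using covering_number_le by metis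
qed

text \<open>A monotone function on a compact interval is integrable; the negation turns the
  decreasing function into an increasing one.\<close>

lemma covering_number_integrable:
  assumes "0 \<le> a"
  shows "(\<lambda>r. real (covering_number G l r)) integrable_on {a..b}"
proof -
  have "mono_on {a..b} (\<lambda>r. - real (covering_number G l r))"
    using assms by (intro mono_onI) (simp add: covering_number_antimono)
  then show ?thesis
    using integrable_neg integrable_on_mono_on by fastforce
qed

text \<open>Packing against covering: two points sharing a centre would be at most
  \<open>2 * r\<close> apart, so choosing a centre for each point is injective.\<close>

lemma card_separated_le_covering_number:
  assumes "0 \<le> r" "A \<subseteq> verts G"
    and separated: "\<And>u v. u \<in> A \<Longrightarrow> v \<in> A \<Longrightarrow> u \<noteq> v \<Longrightarrow> 2 * r < dst u v"
  shows "card A \<le> covering_number G l r"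
proof -
  obtain S where S: "is_cover G l r S" "card S = covering_number G l r"
    using assms(1) covering_number_attained by blast
  then have "\<forall>v\<in>A. \<exists>s\<in>S. dst s v \<le> r"
    using assms(2) by (auto simp: is_cover_def)
  then obtain c where c: "\<And>v. v \<in> A \<Longrightarrow> c v \<in> S \<and> dst (c v) v \<le> r"
    by metis
  have SV: "S \<subseteq> verts G"
    using S(1) by (simp add: is_cover_def)
  have "inj_on c A"
  proof (rule inj_onI, rule ccontr)
    fix u v assume uv: "u \<in> A" "v \<in> A" "c u = c v" "u \<noteq> v"
    have "dst u v \<le> dst u (c u) + dst (c u) v"
      using uv c SV assms(2) by (intro dst_triangle) auto
    also have "dst u (c u) = dst (c u) u"
      using uv c SV assms(2) by (intro dst_commute) auto
    finally have "dst u v \<le> 2 * r"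
      using c[OF uv(1)] c[OF uv(2)] uv(3) by simp
    then show False
      using separated[OF uv(1,2,4)] by simp
  qed
  moreover have "finite S"
    using SV finite_subset finite_verts by blast
  ultimately show ?thesis
    using c S(2) card_inj_on_le[of c A S] by (simp add: image_subset_iff)
qed

end

section \<open>Order of visits and steps of the walk\<close>

locale nuv_walk = length_graph +
  fixes v0 :: 'a
  assumes start: "v0 \<in> verts G"
begin

abbreviation vis :: "nat \<Rightarrow> 'a" where
  "vis \<equiv> nuv G l v0"

definition step :: "nat \<Rightarrow> real" where
  "step i = dst (vis i) (vis (Suc i))"

lemma unvisited_nonempty:
  assumes "Suc i < card (verts G)"
  shows "verts G - vis ` {..i} \<noteq> {}"
proof
  assume "verts G - vis ` {..i} = {}"
  then have "card (verts G) \<le> card (vis ` {..i})"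
    by (intro card_mono) auto
  also have "\<dots> \<le> Suc i"
    using card_image_le[of "{..i}" vis] by simp
  finally show False using assms by simp
qed

lemma vis_Suc_unvisited:
  assumes "Suc i < card (verts G)"
  shows "vis (Suc i) \<in> verts G - vis ` {..i}"
  using arg_min_if_finite(1)[OF _ unvisited_nonempty[OF assms]] by simp

lemma step_le:
  assumes "Suc i < card (verts G)" "v \<in> verts G - vis ` {..i}"
  shows "step i \<le> dst (vis i) v"
  unfolding step_def using assms arg_min_least[of "verts G - vis ` {..i}" v "dst (vis i)"] by auto

lemma vis_in_verts: "i < card (verts G) \<Longrightarrow> vis i \<in> verts G"
  using start vis_Suc_unvisited by (cases i) (simp, blast)

lemma vis_neq:
  assumes "i < j" "j < card (verts G)"
  shows "vis i \<noteq> vis j"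
proof (cases j)
  case (Suc k)
  then have "vis i \<in> vis ` {..k}" "vis j \<notin> vis ` {..k}"
    using assms vis_Suc_unvisited[of k] by (auto simp del: nuv.simps)
  then show ?thesis by metis
qed (use assms in simp)

lemma inj_on_vis: "inj_on vis {..<card (verts G)}"
  by (rule inj_onI) (metis lessThan_iff linorder_neqE_nat vis_neq)

text \<open>As many distinct vertices are visited as the graph has, so none is missed.\<close>

lemma vis_image: "vis ` {..<card (verts G)} = verts G"
  using inj_on_vis vis_in_verts
  by (intro card_subset_eq) (auto simp: card_image)

text \<open>\<open>vis j\<close> is still unvisited when the walk leaves \<open>vis i\<close>, hence
  it competed in that minimisation. Minimality of the greedy choice enters (ii) only through this
  inequality.\<close>

lemma step_le_later:
  assumes "i < j" "j < card (verts G)"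
  shows "step i \<le> dst (vis i) (vis j)"
proof (rule step_le)
  show "vis j \<in> verts G - vis ` {..i}"
  proof (intro DiffI notI)
    assume "vis j \<in> vis ` {..i}"
    then obtain k where "k \<le> i" "vis k = vis j"
      by (metis atMost_iff imageE)
    then show False
      using vis_neq[of k j] assms by simp
  qed (use assms vis_in_verts in blast)
qed (use assms in simp)

lemma step_nonneg: "Suc i < card (verts G) \<Longrightarrow> 0 \<le> step i"
  by (simp add: step_def dst_nonneg vis_in_verts del: nuv.simps)

lemma step_le_diameter: "Suc i < card (verts G) \<Longrightarrow> step i \<le> graph_diameter G l"
  by (simp add: step_def dst_le_diameter vis_in_verts del: nuv.simps)

lemma nuv_length_eq: "nuv_length G l v0 = (\<Sum>i<card (verts G) - 1. step i)"
  unfolding nuv_length_def step_def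
  by (rule sum.reindex_bij_witness[of _ Suc "\<lambda>i. i - 1"]) (auto simp del: nuv.simps)

text \<open>Iterated triangle inequality. The walked length is written as a difference of prefix
  sums, which are the positions along the walk used for (i).\<close>

lemma dst_le_sum_steps:
  assumes "i \<le> j" "j < card (verts G)"
  shows "dst (vis i) (vis j) \<le> (\<Sum>k<j. step k) - (\<Sum>k<i. step k)"
  using assms
proof (induction j rule: dec_induct)
  case base
  then show ?case by (simp add: vis_in_verts)
next
  case (step n)
  have "dst (vis i) (vis (Suc n)) \<le> dst (vis i) (vis n) + dst (vis n) (vis (Suc n))"
    using step.hyps step.prems by (intro dst_triangle vis_in_verts) auto
  then show ?case
    using step.IH step.prems by (simp add: step_def del: nuv.simps)
qed

section \<open>Bound (i): a cover from pieces of the walk\<close>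

lemma covering_number_le_nuv_length:
  assumes "0 < r"
  shows "real (covering_number G l r) \<le> 1 + nuv_length G l v0 / r"
proof -
  define n where "n = card (verts G)"
  \<comment> \<open>\<open>pos i\<close> is the length walked until \<open>vis i\<close> is reached,
    and \<open>piece i\<close> is the number k of the half-open piece from k r to (k + 1) r
    containing it. Some pieces may contain no first visit; \<open>first\<close> is therefore applied
    only to numbers in the image of \<open>piece\<close>.\<close>
  define pos where "pos i = (\<Sum>k<i. step k)" for i
  define piece where "piece i = nat \<lfloor>pos i / r\<rfloor>" for i
  define first where "first k = (LEAST i. piece i = k)" for k
  define S where "S = (\<lambda>k. vis (first k)) ` piece ` {..<n}"
  have pos_nonneg: "0 \<le> pos i" if "i < n" for i
    unfolding pos_def using that by (intro sum_nonneg step_nonneg) (auto simp: n_def)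
  have pos_le: "pos i \<le> nuv_length G l v0" if "i < n" for i
    unfolding pos_def nuv_length_eq using that
    by (intro sum_mono2) (auto simp: n_def intro!: step_nonneg)
  have first: "piece (first (piece i)) = piece i" "first (piece i) \<le> i" for i
    unfolding first_def by (rule LeastI, rule refl) (rule Least_le, rule refl)
  have "is_cover G l r S"
    unfolding is_cover_def
  proof (intro conjI ballI)
    show "S \<subseteq> verts G"
      unfolding S_def n_def using first(2) by (auto intro!: vis_in_verts intro: le_less_trans)
    fix v assume "v \<in> verts G"
    then obtain i where i: "i < n" "v = vis i"
      unfolding n_def using vis_image by force
    define j where "j = first (piece i)"
    have j: "j \<le> i" "piece j = piece i" "j < n"
      using first[of i] i(1) by (auto simp: j_def)
    \<comment> \<open>Positions are nonnegative, so \<open>nat\<close> identifies no two different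
      floors here.\<close>
    have "\<lfloor>pos j / r\<rfloor> = \<lfloor>pos i / r\<rfloor>"
      using j(2) pos_nonneg[OF i(1)] pos_nonneg[OF j(3)] assms
      by (simp add: piece_def eq_nat_nat_iff)
    then have "pos i / r - pos j / r < 1"
      by linarith
    then have "pos i - pos j \<le> r"
      using assms by (simp add: field_simps)
    then have "dst (vis j) v \<le> r"
      using dst_le_sum_steps[OF j(1)] i by (simp add: pos_def n_def)
    moreover have "vis j \<in> S"
      using i(1) by (auto simp: S_def j_def)
    ultimately show "\<exists>s\<in>S. dst s v \<le> r" by blast
  qed
  then have "covering_number G l r \<le> card S"
    by (rule covering_number_le)
  also have "card S \<le> card (piece ` {..<n})"
    unfolding S_def by (rule card_image_le) simp
  \<comment> \<open>The summand 1 in the bound arises here: the pieces are numbered from 0.\<close>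
  also have "\<dots> \<le> card {..nat \<lfloor>nuv_length G l v0 / r\<rfloor>}"
    using pos_le assms
    by (intro card_mono) (auto simp: piece_def intro!: nat_mono floor_mono divide_right_mono)
  finally have "real (covering_number G l r) \<le> 1 + real (nat \<lfloor>nuv_length G l v0 / r\<rfloor>)"
    by simp
  moreover have "0 \<le> nuv_length G l v0"
    unfolding nuv_length_eq by (intro sum_nonneg step_nonneg) auto
  then have "real (nat \<lfloor>nuv_length G l v0 / r\<rfloor>) \<le> nuv_length G l v0 / r"
    using assms by (intro of_nat_floor) simp
  ultimately show ?thesis by linarith
qed

section \<open>Bound (ii): counting long steps and integrating\<close>

lemma card_long_steps_le:
  assumes "0 \<le> r"
  shows "card {i. i < card (verts G) - 1 \<and> 2 * r < step i} \<le> covering_number G l r"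
proof -
  define I where "I = {i. i < card (verts G) - 1 \<and> 2 * r < step i}"
  \<comment> \<open>Only the earlier of the two steps has to be long; symmetry of \<open>dst\<close>
    later removes the assumption on the order.\<close>
  have far: "2 * r < dst (vis i) (vis j)" if "i \<in> I" "j \<in> I" "i < j" for i j
  proof -
    have "2 * r < step i" "j < card (verts G)"
      using that by (auto simp: I_def)
    then show ?thesis
      using step_le_later[OF \<open>i < j\<close>] by simp
  qed
  have "I \<subseteq> {..<card (verts G)}"
    by (auto simp: I_def)
  then have "card I = card (vis ` I)"
    by (metis card_image inj_on_subset inj_on_vis)
  also have "\<dots> \<le> covering_number G l r"
  proof (rule card_separated_le_covering_number[OF assms])
    show V: "vis ` I \<subseteq> verts G"
      by (auto simp: I_def intro: vis_in_verts)
    fix u v assume uv: "u \<in> vis ` I" "v \<in> vis ` I" "u \<noteq> v"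
    then obtain i j where ij: "i \<in> I" "j \<in> I" "u = vis i" "v = vis j" "i < j \<or> j < i"
      by (metis imageE linorder_neqE_nat)
    moreover have "dst u v = dst v u"
      using uv V by (intro dst_commute) auto
    ultimately show "2 * r < dst u v"
      using far by metis
  qed
  finally show ?thesis
    by (simp add: I_def)
qed

text \<open>Layer-cake formula: half of a step is the integral over r of the indicator of
  \<open>2 * r < step i\<close>. Summed over the steps, the integrand counts the long steps, which
  the covering number bounds pointwise.\<close>

lemma nuv_length_le_integral:
  "nuv_length G l v0 \<le>
     2 * integral {0..graph_diameter G l / 2} (\<lambda>r. real (covering_number G l r))"
proof -
  define n where "n = card (verts G) - 1"
  define T where "T = {0..graph_diameter G l / 2}"
  have long: "((\<lambda>r. of_bool (2 * r < step i)) has_integral step i / 2) T" if "i < n" for i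
  proof -
    have i: "0 \<le> step i" "{0..step i / 2} \<subseteq> T"
      \<comment> \<open>No step exceeds the diameter, so integrating up to half the diameter
        captures each step in full.\<close>
      using that step_nonneg[of i] step_le_diameter[of i] by (auto simp: n_def T_def)
    have "((\<lambda>_. 1 :: real) has_integral step i / 2) {0..step i / 2}"
      using has_integral_const_real[of "1 :: real" 0 "step i / 2"] i(1) by simp
    then have "((\<lambda>r. if r \<in> {0..step i / 2} then 1 else 0 :: real) has_integral step i / 2) T"
      using has_integral_restrict[OF i(2), of "\<lambda>_. 1 :: real"] by simp
    then show ?thesis
      \<comment> \<open>On \<open>T\<close> the strict condition \<open>2 * r < step i\<close> and
        membership in the closed interval differ only at the endpoint
        \<open>step i / 2\<close>.\<close>
      by (rule has_integral_spike_finite[rotated 2, where S = "{step i / 2}"]) (auto simp: T_def)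
  qed
  have "((\<lambda>r. \<Sum>i<n. of_bool (2 * r < step i)) has_integral (\<Sum>i<n. step i / 2)) T"
    using long by (intro has_integral_sum) auto
  moreover have "((\<lambda>r. real (covering_number G l r)) has_integral
      integral T (\<lambda>r. real (covering_number G l r))) T"
    unfolding T_def using covering_number_integrable by (intro integrable_integral) simp
  moreover have "(\<Sum>i<n. of_bool (2 * r < step i)) \<le> real (covering_number G l r)" if "r \<in> T" for r
  proof -
    have "(\<Sum>i<n. of_bool (2 * r < step i)) = real (card {i. i < n \<and> 2 * r < step i})"
      by (simp add: of_bool_def sum.If_cases lessThan_def Collect_conj_eq)
    then show ?thesis
      using card_long_steps_le[of r] that by (simp add: T_def n_def)
  qed
  ultimately have "(\<Sum>i<n. step i / 2) \<le> integral T (\<lambda>r. real (covering_number G l r))"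
    by (rule has_integral_le)
  then show ?thesis
    by (simp add: nuv_length_eq n_def T_def flip: sum_divide_distrib)
qed

end

theorem proposition1:
  fixes G :: "('a, 'b) pre_digraph" and l :: "'b \<Rightarrow> real" and v0 :: 'a
  assumes "graph G" and "Digraph_Component.connected G"
    and "edge_lengths G l"
    and "distinct_distances G l"
    and "v0 \<in> verts G"
  shows "(\<forall>r>0. real (covering_number G l r) \<le> 1 + nuv_length G l v0 / r) \<and>
         nuv_length G l v0 \<le>
           2 * integral {0..graph_diameter G l / 2} (\<lambda>r. real (covering_number G l r))"
proof -
  interpret nuv_walk G l v0
    using assms by (simp add: nuv_walk_def nuv_walk_axioms_def length_graph_def length_graph_axioms_def)
  show ?thesis
    using covering_number_le_nuv_length nuv_length_le_integral by blast
qed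

end
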